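(* Let $k\in\mathbb{N}$, let $\phi,\psi,a,b,\eta,\xi>0$ be real numbers, let $P,Q,R,S\in\mathscr{M}_k$, and let $m\ge 0$ be an integer. Then $$\mathfrak{BL}_{(\phi,\psi)}^{(R,S,\eta,\xi)}(a,b;P,Q)=\sum_{n=0}^{m} \binom{m}{n}\mathfrak{BL}_{(\phi,\psi)}^{(R,S,\eta,\xi)}(a,b;P+nI,Q+(m-n)I).$$
   Context: $\mathscr{M}_k$ is the set of $k\times k$ complex Hermitian matrices that are positive stable (all eigenvalues have positive real part). $I$ is the $k\times k$ identity matrix. For $x>0$ and a square matrix $A$, $x^{A}=\exp(A\ln x)$. The two-parameter Mittag-Leffler matrix function is $\mathcal{E}_{(\phi,\psi)}(A)=\sum_{n=0}^{\infty}\frac{A^n}{\Gamma(\phi n+\psi)}$ for $\phi,\psi>0$. For real $\phi,\psi,\eta,\xi,a,b>0$ and $P,Q,R,S\in\mathscr{M}_k$ the generalized beta-logarithmic matrix function is $$\mathfrak{BL}_{(\phi,\psi)}^{(R,S,\eta,\xi)}(a,b;P,Q)=\int_{0}^{1}a^{1-x}b^{x}x^{P-I}(1-x)^{Q-I}\mathcal{E}_{(\phi,\psi)}\left(-\frac{R}{x^{\eta}}\right)\mathcal{E}_{(\phi,\psi)}\left(-\frac{S}{(1-x)^{\xi}}\right)dx,$$ with matrix products taken in the written order.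
   Formalization: The integral defining the left-hand side diverges for some admissible parameters (e.g. k=1, φ=4, ψ=1, all others 1); the equality is therefore stated when that integral exists, and it is also shown that it exists if and only if all m+1 integrals on the right exist. *)

theory Defs
  imports "HOL-Analysis.Analysis"
begin

type_synonym 'k cmat = "complex ^ 'k ^ 'k"

definition hermitian :: "'k::finite cmat \<Rightarrow> bool" where
  "hermitian A \<longleftrightarrow> map_matrix cnj (transpose A) = A"

definition is_eigenvalue :: "'k::finite cmat \<Rightarrow> complex \<Rightarrow> bool" where
  "is_eigenvalue A l \<longleftrightarrow> (\<exists>v. v \<noteq> 0 \<and> A *v v = l *s v)"

definition positive_stable :: "'k::finite cmat \<Rightarrow> bool" where
  "positive_stable A \<longleftrightarrow> (\<forall>l. is_eigenvalue A l \<longrightarrow> 0 < Re l)"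

definition herm_pos_stable :: "'k::finite cmat set" where
  "herm_pos_stable = {A. hermitian A \<and> positive_stable A}"

(* The type class power on vectors is componentwise, so powers with respect to
   the matrix product, and the power series built on them, are defined here. *)

primrec mat_pow :: "'k::finite cmat \<Rightarrow> nat \<Rightarrow> 'k cmat" where
  "mat_pow A 0 = mat 1"
| "mat_pow A (Suc n) = A ** mat_pow A n"

definition mat_exp :: "'k::finite cmat \<Rightarrow> 'k cmat" where
  "mat_exp A = (\<Sum>n. mat_pow A n /\<^sub>R fact n)"

(* Meaningful for x > 0 only. *)
definition mat_powr :: "real \<Rightarrow> 'k::finite cmat \<Rightarrow> 'k cmat" where
  "mat_powr x A = mat_exp (ln x *\<^sub>R A)"

definition mittag_leffler :: "real \<Rightarrow> real \<Rightarrow> 'k::finite cmat \<Rightarrow> 'k cmat" where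
  "mittag_leffler \<phi> \<psi> A = (\<Sum>n. mat_pow A n /\<^sub>R Gamma (\<phi> * real n + \<psi>))"

definition BL_integrand ::
  "real \<Rightarrow> real \<Rightarrow> 'k::finite cmat \<Rightarrow> 'k cmat \<Rightarrow> real \<Rightarrow> real \<Rightarrow> real \<Rightarrow> real \<Rightarrow> 'k cmat \<Rightarrow> 'k cmat
    \<Rightarrow> real \<Rightarrow> 'k cmat" where
  "BL_integrand \<phi> \<psi> R S \<eta> \<xi> a b P Q x =
     (a powr (1 - x) * b powr x) *\<^sub>R
       (mat_powr x (P - mat 1) ** mat_powr (1 - x) (Q - mat 1)
         ** mittag_leffler \<phi> \<psi> (- (R /\<^sub>R (x powr \<eta>)))
         ** mittag_leffler \<phi> \<psi> (- (S /\<^sub>R ((1 - x) powr \<xi>))))"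

(* The integral is the gauge (Henstock-Kurzweil) integral, which covers the Lebesgue integral
   as well as conditionally convergent improper integrals. It is divergent for some admissible
   parameters (in general for \<phi> > 2, where the Mittag-Leffler function grows exponentially along
   the negative real axis); integral then returns the dummy value 0, so
   existence is recorded by a predicate of its own. *)

definition BL_converges ::
  "real \<Rightarrow> real \<Rightarrow> 'k::finite cmat \<Rightarrow> 'k cmat \<Rightarrow> real \<Rightarrow> real \<Rightarrow> real \<Rightarrow> real \<Rightarrow> 'k cmat \<Rightarrow> 'k cmat
    \<Rightarrow> bool" where
  "BL_converges \<phi> \<psi> R S \<eta> \<xi> a b P Q \<longleftrightarrow>
     BL_integrand \<phi> \<psi> R S \<eta> \<xi> a b P Q integrable_on {0<..<1}"

definition BL ::
  "real \<Rightarrow> real \<Rightarrow> 'k::finite cmat \<Rightarrow> 'k cmat \<Rightarrow> real \<Rightarrow> real \<Rightarrow> real \<Rightarrow> real \<Rightarrow> 'k cmat \<Rightarrow> 'k cmat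
    \<Rightarrow> 'k cmat" where
  "BL \<phi> \<psi> R S \<eta> \<xi> a b P Q = integral {0<..<1} (BL_integrand \<phi> \<psi> R S \<eta> \<xi> a b P Q)"

end

theory Submission
  imports Defs
begin

text \<open>Since the identity matrix is central, replacing \<open>P\<close>, \<open>Q\<close> by \<open>P + nI\<close>, \<open>Q + (m - n)I\<close> multiplies the
  integrand by the scalar \<open>x\<^sup>n (1 - x)\<^bsup>m - n\<^esup>\<close>, and these weights add up to \<open>1\<close> by the binomial theorem. For
  the gauge integral the only delicate point is that each weighted integrand is integrable
  when the original one is: both factors of the weight are monotone, and the second mean value
  theorem says that multiplication by a monotone function preserves integrability, even if the
  integral converges only conditionally.\<close>

lemma matrix_mult_scaleR:
  fixes A :: "'a::real_algebra_1 ^ 'n ^ 'm"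
  shows "(c *\<^sub>R A) ** B = c *\<^sub>R (A ** B)" "A ** (c *\<^sub>R B) = c *\<^sub>R (A ** B)"
  by (simp_all add: matrix_scalar_ac scalar_matrix_assoc)

lemma matrix_add_mult_distrib:
  fixes A B :: "'a::semiring_1 ^ 'n ^ 'm"
  shows "(A + B) ** C = A ** C + B ** C"
  by (vector matrix_matrix_mult_def sum.distrib[symmetric] field_simps)

text \<open>The binomial theorem for the commuting matrices \<open>A\<close> and
  \<open>t *\<^sub>R mat 1\<close>, in divided powers: the right side is then literally a term of a
  Cauchy product of two exponential series.\<close>

lemma mat_pow_divided_shift:
  fixes A :: "'k::finite cmat" and t :: real
  shows "mat_pow (A + t *\<^sub>R mat 1) n /\<^sub>R fact n =
    (\<Sum>i\<le>n. (t ^ (n - i) / fact (n - i)) *\<^sub>R (mat_pow A i /\<^sub>R fact i))"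
proof (induction n)
  case 0
  show ?case by simp
next
  case (Suc n)
  define S where "S B k = mat_pow B k /\<^sub>R fact k" for B :: "'k cmat" and k
  define T where "T k = t ^ k / fact k" for k
  have mult_S: "B ** S B k = real (Suc k) *\<^sub>R S B (Suc k)" for B k
    by (simp add: S_def matrix_mult_scaleR del: of_nat_Suc)
  have mult_T: "t * T k = real (Suc k) * T (Suc k)" for k
    by (simp add: T_def del: of_nat_Suc)
  have mult_sum: "A ** (\<Sum>i\<le>k. f i) = (\<Sum>i\<le>k. A ** f i)" for f :: "nat \<Rightarrow> 'k cmat" and k :: nat
    by (induction k) (simp_all add: matrix_add_ldistrib)
  \<comment> \<open>The factor \<open>Suc n\<close> clears the denominators. Multiplying by
    \<open>A\<close> or by \<open>t\<close> raises the degree of one divided power and produces the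
    weights \<open>i\<close> and \<open>Suc n - i\<close>, which add up to
    \<open>Suc n\<close>.\<close>
  have "real (Suc n) *\<^sub>R S (A + t *\<^sub>R mat 1) (Suc n)
      = (A + t *\<^sub>R mat 1) ** (\<Sum>i\<le>n. T (n - i) *\<^sub>R S A i)"
    using Suc.IH mult_S[of "A + t *\<^sub>R mat 1" n] by (simp add: S_def T_def)
  also have "\<dots> = (\<Sum>i\<le>n. T (n - i) *\<^sub>R (A ** S A i)) + (\<Sum>i\<le>n. (t * T (n - i)) *\<^sub>R S A i)"
    by (simp add: matrix_add_mult_distrib mult_sum matrix_mult_scaleR scaleR_sum_right)
  \<comment> \<open>Both sums are extended to the range up to \<open>Suc n\<close>: the new term has
    weight zero, at \<open>i = 0\<close> here and at \<open>i = Suc n\<close> in the next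
    sum.\<close>
  also have "(\<Sum>i\<le>n. T (n - i) *\<^sub>R (A ** S A i))
      = (\<Sum>i\<le>Suc n. real i *\<^sub>R (T (Suc n - i) *\<^sub>R S A i))"
    by (subst sum.atMost_Suc_shift) (simp add: mult_S mult.commute del: of_nat_Suc)
  also have "(\<Sum>i\<le>n. (t * T (n - i)) *\<^sub>R S A i)
      = (\<Sum>i\<le>Suc n. real (Suc n - i) *\<^sub>R (T (Suc n - i) *\<^sub>R S A i))"
    by (simp add: mult_T Suc_diff_le del: of_nat_Suc of_nat_diff)
  also have "(\<Sum>i\<le>Suc n. real i *\<^sub>R (T (Suc n - i) *\<^sub>R S A i))
      + (\<Sum>i\<le>Suc n. real (Suc n - i) *\<^sub>R (T (Suc n - i) *\<^sub>R S A i))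
      = real (Suc n) *\<^sub>R (\<Sum>i\<le>Suc n. T (Suc n - i) *\<^sub>R S A i)"
    unfolding sum.distrib[symmetric] scaleR_sum_right
    by (intro sum.cong refl) (simp add: algebra_simps flip: scaleR_add_left)
  finally have "S (A + t *\<^sub>R mat 1) (Suc n) = (\<Sum>i\<le>Suc n. T (Suc n - i) *\<^sub>R S A i)"
    unfolding scaleR_cancel_left by simp
  then show ?case
    unfolding S_def T_def .
qed

text \<open>An entry of a matrix product is a sum of \<open>CARD('k)\<close> products of entries, so
  each further factor \<open>A\<close> costs at most \<open>CARD('k) * c\<close>.\<close>

lemma norm_mat_pow_entry_le:
  fixes A :: "'k::finite cmat"
  assumes "\<And>i j. norm (A $ i $ j) \<le> c"
  shows "norm (mat_pow A n $ i $ j) \<le> (real CARD('k) * c) ^ n"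
proof (induction n arbitrary: i)
  case 0
  show ?case by (simp add: mat_def)
next
  case (Suc n)
  have "norm (mat_pow A (Suc n) $ i $ j) \<le> (\<Sum>l\<in>UNIV. norm (A $ i $ l * mat_pow A n $ l $ j))"
    by (simp add: matrix_matrix_mult_def norm_sum)
  also have "\<dots> \<le> (\<Sum>l\<in>(UNIV::'k set). c * (real CARD('k) * c) ^ n)"
    unfolding norm_mult
    using assms Suc order_trans[OF norm_ge_zero assms] by (intro sum_mono mult_mono) auto
  finally show ?case by (simp add: mult.assoc)
qed

text \<open>Comparison with the scalar exponential series at \<open>CARD('k) * c\<close>, where
  \<open>c\<close> is the largest modulus of an entry of \<open>A\<close>. Absolute convergence in
  each entry is what the Cauchy product requires.\<close>

lemma summable_norm_mat_exp_entry:
  fixes A :: "'k::finite cmat"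
  shows "summable (\<lambda>n. norm ((mat_pow A n /\<^sub>R fact n) $ i $ j))"
proof -
  define c where "c = Max (range (\<lambda>(i, j). norm (A $ i $ j)))"
  have "norm (A $ i $ j) \<le> c" for i j
    unfolding c_def by (rule Max_ge) (auto intro: range_eqI[of _ _ "(i, j)"])
  then have le: "norm (mat_pow A n $ i $ j) \<le> (real CARD('k) * c) ^ n" for n
    by (rule norm_mat_pow_entry_le)
  show ?thesis
  proof (rule summable_comparison_test')
    show "summable (\<lambda>n. (real CARD('k) * c) ^ n /\<^sub>R fact n)"
      by (rule summable_exp_generic)
    show "norm (norm ((mat_pow A n /\<^sub>R fact n) $ i $ j)) \<le> (real CARD('k) * c) ^ n /\<^sub>R fact n" for n
      using le[of n] by (simp add: mult_left_mono)
  qed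
qed

text \<open>Shows that the \<open>suminf\<close> defining \<open>mat_exp\<close> is a genuine limit,
  by assembling the entrywise limits into a matrix.\<close>

lemma mat_exp_sums: "(\<lambda>n. mat_pow A n /\<^sub>R fact n) sums mat_exp A"
proof -
  define L :: "'a cmat" where "L = (\<chi> i j. \<Sum>n. (mat_pow A n /\<^sub>R fact n) $ i $ j)"
  have "(\<lambda>n. (mat_pow A n /\<^sub>R fact n) $ i $ j) sums (L $ i $ j)" for i j
    unfolding L_def vec_lambda_beta
    by (intro summable_sums summable_norm_cancel[OF summable_norm_mat_exp_entry])
  then have "(\<lambda>n. mat_pow A n /\<^sub>R fact n) sums L"
    unfolding sums_def by (intro vec_tendstoI) (simp only: sum_component)
  then show ?thesis
    unfolding mat_exp_def by (intro summable_sums sums_summable)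
qed

text \<open>A scalar matrix acts on each entry separately, so every entry is a Cauchy product of two
  complex series and no product of matrix series is needed.\<close>

lemma mat_exp_add_scalar:
  "mat_exp (A + t *\<^sub>R mat 1) = exp t *\<^sub>R mat_exp A"
proof -
  have "mat_exp (A + t *\<^sub>R mat 1) $ i $ j = (exp t *\<^sub>R mat_exp A) $ i $ j" for i j
  proof -
    let ?a = "\<lambda>n. (mat_pow A n /\<^sub>R fact n) $ i $ j"
    let ?t = "\<lambda>n. complex_of_real t ^ n /\<^sub>R fact n"
    have A: "(\<lambda>n. (mat_pow B n /\<^sub>R fact n) $ i $ j) sums (mat_exp B $ i $ j)" for B
      by (intro sums_vec_nth mat_exp_sums)
    have "(\<lambda>n. \<Sum>l\<le>n. ?a l * ?t (n - l)) sums (suminf ?a * suminf ?t)"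
      by (intro Cauchy_product_sums summable_norm_mat_exp_entry summable_norm_exp)
    moreover have "(\<Sum>l\<le>n. ?a l * ?t (n - l)) = (mat_pow (A + t *\<^sub>R mat 1) n /\<^sub>R fact n) $ i $ j" for n
      unfolding mat_pow_divided_shift sum_component vector_scaleR_component
      by (intro sum.cong refl) (simp add: scaleR_conv_of_real field_simps)
    moreover have "suminf ?a = mat_exp A $ i $ j"
      using sums_unique[OF A[of A]] by simp
    moreover have "suminf ?t = exp t"
      unfolding exp_of_real[symmetric] by (simp add: exp_def)
    ultimately have "(\<lambda>n. (mat_pow (A + t *\<^sub>R mat 1) n /\<^sub>R fact n) $ i $ j)
        sums (mat_exp A $ i $ j * exp t)"
      by simp
    from sums_unique2[OF A this] show ?thesis
      unfolding vector_scaleR_component by (simp add: scaleR_conv_of_real mult.commute)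
  qed
  then show ?thesis
    by (simp add: vec_eq_iff)
qed

lemma mat_powr_add_nat:
  assumes "x > 0"
  shows "mat_powr x (A + real n *\<^sub>R mat 1) = x ^ n *\<^sub>R mat_powr x A"
proof -
  have "ln x *\<^sub>R (A + real n *\<^sub>R mat 1) = ln x *\<^sub>R A + (real n * ln x) *\<^sub>R mat 1"
    by (simp add: scaleR_add_right mult.commute)
  then show ?thesis
    using assms by (simp add: mat_powr_def mat_exp_add_scalar exp_of_nat_mult)
qed

text \<open>The second mean value theorem concerns real-valued functions, hence the passage to
  components. Only the existence of the integral is kept from it, not the value.\<close>

lemma integrable_mono_scaleR:
  fixes f :: "real \<Rightarrow> 'a::euclidean_space" and g :: "real \<Rightarrow> real"
  assumes f: "f integrable_on {a..b}" and g: "mono_on {a..b} g"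
  shows "(\<lambda>x. g x *\<^sub>R f x) integrable_on {a..b}"
proof (cases "a \<le> b")
  case True
  show ?thesis
  proof (rule integrable_componentwise)
    fix i :: 'a assume "i \<in> Basis"
    then have "(\<lambda>x. f x \<bullet> i) integrable_on {a..b}"
      using f integrable_componentwise_iff by blast
    then obtain c where "((\<lambda>x. g x * (f x \<bullet> i)) has_integral
        g a * integral {a..c} (\<lambda>x. f x \<bullet> i) + g b * integral {c..b} (\<lambda>x. f x \<bullet> i)) {a..b}"
      by (rule second_mean_value_theorem_full[OF _ True, of _ g]) (use g in \<open>auto simp: mono_on_def\<close>)
    then show "(\<lambda>x. g x *\<^sub>R f x \<bullet> i) integrable_on {a..b}"
      by (auto simp: integrable_on_def)
  qed
qed (simp add: integrable_on_empty)

lemma integrable_antimono_scaleR: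
  fixes f :: "real \<Rightarrow> 'a::euclidean_space" and g :: "real \<Rightarrow> real"
  assumes f: "f integrable_on {a..b}" and g: "antimono_on {a..b} g"
  shows "(\<lambda>x. g x *\<^sub>R f x) integrable_on {a..b}"
proof -
  have "mono_on {a..b} (\<lambda>x. - g x)"
    using g by (auto simp: monotone_on_def)
  from integrable_neg[OF integrable_mono_scaleR[OF f this]] show ?thesis
    by simp
qed

lemma integrable_Bernstein_scaleR:
  fixes f :: "real \<Rightarrow> 'a::euclidean_space"
  assumes "f integrable_on {0<..<1}"
  shows "(\<lambda>x. (x ^ n * (1 - x) ^ k) *\<^sub>R f x) integrable_on {0<..<1}"
proof -
  have "mono_on {0..1::real} (\<lambda>x. x ^ n)" "antimono_on {0..1::real} (\<lambda>x. (1 - x) ^ k)"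
    by (auto simp: monotone_on_def intro!: power_mono)
  \<comment> \<open>The product of the two weights need not be monotone, so they are applied one
    after the other. Passing to the closed interval does not affect integrability.\<close>
  with assms have "(\<lambda>x. x ^ n *\<^sub>R (1 - x) ^ k *\<^sub>R f x) integrable_on {0..1}"
    unfolding integrable_on_open_interval_real
    by (intro integrable_mono_scaleR integrable_antimono_scaleR)
  then show ?thesis
    unfolding integrable_on_open_interval_real by simp
qed

text \<open>On the open interval both bases \<open>x\<close> and \<open>1 - x\<close> are positive,
  so \<open>mat_powr_add_nat\<close> applies to each and the scalars move out of the product. The
  Mittag-Leffler factors stay untouched, so nothing about their series enters.\<close>

lemma BL_integrand_shift:
  assumes "x \<in> {0<..<1}"
  shows "BL_integrand \<phi> \<psi> R S \<eta> \<xi> a b (P + real n *\<^sub>R mat 1) (Q + real k *\<^sub>R mat 1) x =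
    (x ^ n * (1 - x) ^ k) *\<^sub>R BL_integrand \<phi> \<psi> R S \<eta> \<xi> a b P Q x"
proof -
  have "mat_powr x (P + real n *\<^sub>R mat 1 - mat 1) = x ^ n *\<^sub>R mat_powr x (P - mat 1)"
    "mat_powr (1 - x) (Q + real k *\<^sub>R mat 1 - mat 1) = (1 - x) ^ k *\<^sub>R mat_powr (1 - x) (Q - mat 1)"
    using assms mat_powr_add_nat[of x "P - mat 1" n] mat_powr_add_nat[of "1 - x" "Q - mat 1" k]
    by (simp_all add: diff_add_eq)
  then show ?thesis
    unfolding BL_integrand_def
    by (simp add: matrix_mult_scaleR mult_ac)
qed

lemma BL_integrand_binomial:
  assumes "x \<in> {0<..<1}"
  shows "(\<Sum>n=0..m. real (m choose n) *\<^sub>R BL_integrand \<phi> \<psi> R S \<eta> \<xi> a b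
      (P + real n *\<^sub>R mat 1) (Q + real (m - n) *\<^sub>R mat 1) x) = BL_integrand \<phi> \<psi> R S \<eta> \<xi> a b P Q x"
proof -
  have "(\<Sum>n=0..m. real (m choose n) * (x ^ n * (1 - x) ^ (m - n))) = 1"
    using binomial_ring[of x "1 - x" m] by (simp add: atLeast0AtMost mult.assoc)
  then show ?thesis
    by (simp add: BL_integrand_shift[OF assms] del: of_nat_diff flip: scaleR_sum_left)
qed

theorem theorem3p4:
  fixes \<phi> \<psi> a b \<eta> \<xi> :: real
    and P Q R S :: "complex ^ 'k::finite ^ 'k"
    and m :: nat
  assumes "\<phi> > 0" "\<psi> > 0" "a > 0" "b > 0" "\<eta> > 0" "\<xi> > 0"
    and "P \<in> herm_pos_stable" "Q \<in> herm_pos_stable"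
        "R \<in> herm_pos_stable" "S \<in> herm_pos_stable"
  shows "(BL_converges \<phi> \<psi> R S \<eta> \<xi> a b P Q \<longleftrightarrow>
            (\<forall>n\<le>m. BL_converges \<phi> \<psi> R S \<eta> \<xi> a b
               (P + real n *\<^sub>R mat 1) (Q + real (m - n) *\<^sub>R mat 1))) \<and>
         (BL_converges \<phi> \<psi> R S \<eta> \<xi> a b P Q \<longrightarrow>
            BL \<phi> \<psi> R S \<eta> \<xi> a b P Q =
              (\<Sum>n=0..m. real (m choose n) *\<^sub>R
                 BL \<phi> \<psi> R S \<eta> \<xi> a b (P + real n *\<^sub>R mat 1) (Q + real (m - n) *\<^sub>R mat 1)))"
proof -
  let ?F = "BL_integrand \<phi> \<psi> R S \<eta> \<xi> a b P Q"
  let ?G = "\<lambda>n. BL_integrand \<phi> \<psi> R S \<eta> \<xi> a b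
    (P + real n *\<^sub>R mat 1) (Q + real (m - n) *\<^sub>R mat 1)"
  have shifted: "?G n integrable_on {0<..<1}" if "?F integrable_on {0<..<1}" for n
    using integrable_Bernstein_scaleR[OF that, of n "m - n"]
    by (rule integrable_eq) (simp add: BL_integrand_shift)
  \<comment> \<open>Assuming only that the shifted integrals exist gives the converse convergence
    claim and the formula at once.\<close>
  have sum: "(?F has_integral (\<Sum>n=0..m. real (m choose n) *\<^sub>R integral {0<..<1} (?G n))) {0<..<1}"
    if "\<And>n. n \<le> m \<Longrightarrow> ?G n integrable_on {0<..<1}"
  proof (rule has_integral_eq[OF BL_integrand_binomial])
    show "((\<lambda>x. \<Sum>n=0..m. real (m choose n) *\<^sub>R ?G n x) has_integral
        (\<Sum>n=0..m. real (m choose n) *\<^sub>R integral {0<..<1} (?G n))) {0<..<1}"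
      by (intro has_integral_sum has_integral_cmul integrable_integral that) simp_all
  qed
  show ?thesis
    unfolding BL_converges_def BL_def
    using shifted sum by (blast intro: integral_unique has_integral_integrable)
qed

end
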